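(* Let $G$ be a finite abstract simplicial complex and let $k \geq 1$. Then $$\omega_k(G) = \sum_{p=0}^{\infty} (-1)^p \dim\big(H^p_k(G)\big).$$
   Context: A finite abstract simplicial complex $G$ is a finite set of nonempty finite sets closed under taking nonempty subsets; its elements are called simplices, $\dim(x)=|x|-1$ and $\omega(x)=(-1)^{\dim(x)}$. Fix an orientation (an ordering of the vertices, up to even permutations) of every simplex. For an oriented simplex $x=(v_0,\dots,v_m)$ with $m\ge 1$ its boundary chain is $\delta x=\sum_{i=0}^m (-1)^i (v_0,\dots,\hat v_i,\dots,v_m)$, a formal linear combination of faces, where a face listed with the opposite of its chosen orientation counts with a minus sign; $\delta x=0$ if $m=0$. For complexes $G_1,\dots,G_k$, an interacting $k$-tuple is $(x_1,\dots,x_k)$ with $x_j\in G_j$ and $x_i\cap x_j\neq\emptyset$ for all $i,j$; its degree is $\sum_j \dim(x_j)$. The space $\Omega^p$ of $p$-forms is the real vector space of functions on interacting $k$-tuples of degree $p$; such a function is extended by zero to non-interacting tuples and multilinearly to chains. The exterior derivative $d:\Omega^p\to\Omega^{p+1}$ is $(dF)(x_1,\dots,x_k)=\sum_{j=1}^k (-1)^{\sum_{i<j}\dim(x_i)} F(x_1,\dots,x_{j-1},\delta x_j,x_{j+1},\dots,x_k)$; it satisfies $d\circ d=0$. The $k$-interaction cohomology is $H^p_k(G_1,\dots,G_k)=\ker(d|_{\Omega^p})/\mathrm{im}(d|_{\Omega^{p-1}})$, and $H^p_k(G):=H^p_k(G,\dots,G)$ ($k$ copies). The $k$-th Wu characteristic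 is $\omega_k(G)=\sum \omega(x_1)\cdots\omega(x_k)$, the sum over all interacting $k$-tuples $(x_1,\dots,x_k)$ of simplices of $G$ (so $\omega_1(G)$ is the Euler characteristic). *)

theory Defs
  imports
    "Jordan_Normal_Form.VS_Connect"
    "HOL-Algebra.AbelCoset"
    "HOL-Combinatorics.Permutations"
    "HOL-Library.Poly_Mapping"
begin

definition finite_simplicial_complex :: "'a set set \<Rightarrow> bool" where
  "finite_simplicial_complex G \<longleftrightarrow>
     finite G \<and>
     (\<forall>x\<in>G. finite x \<and> x \<noteq> {}) \<and>
     (\<forall>x\<in>G. \<forall>y. y \<subseteq> x \<and> y \<noteq> {} \<longrightarrow> y \<in> G)"

definition simplex_dim :: "'a set \<Rightarrow> nat" where
  "simplex_dim x = card x - 1"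

definition simplex_sign :: "'a set \<Rightarrow> int" where
  "simplex_sign x = (- 1) ^ simplex_dim x"

text \<open>An orientation is given by one representative vertex ordering of every simplex.\<close>

definition orientation_of :: "'a set set \<Rightarrow> ('a set \<Rightarrow> 'a list) \<Rightarrow> bool" where
  "orientation_of G ori \<longleftrightarrow> (\<forall>x\<in>G. distinct (ori x) \<and> set (ori x) = x)"

text \<open>For two orderings of the same vertex set: the sign of the permutation
  that sends the i-th vertex of the first to the i-th vertex of the second.\<close>

definition relative_sign :: "'a list \<Rightarrow> 'a list \<Rightarrow> int" where
  "relative_sign us vs = sign (permutation_of_list (zip us vs))"

definition oriented_chain :: "('a set \<Rightarrow> 'a list) \<Rightarrow> 'a list \<Rightarrow> ('a set \<Rightarrow>\<^sub>0 int)" where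
  "oriented_chain ori vs = frag_cmul (relative_sign vs (ori (set vs))) (frag_of (set vs))"

definition boundary_chain :: "('a set \<Rightarrow> 'a list) \<Rightarrow> 'a set \<Rightarrow> ('a set \<Rightarrow>\<^sub>0 int)" where
  "boundary_chain ori x =
     (if simplex_dim x = 0 then 0
      else \<Sum>i\<le>simplex_dim x.
             frag_cmul ((- 1) ^ i)
               (oriented_chain ori (take i (ori x) @ drop (Suc i) (ori x))))"

definition interacting_tuples :: "'a set set list \<Rightarrow> 'a set list set" where
  "interacting_tuples Gs =
     {xs. length xs = length Gs \<and>
          (\<forall>j<length Gs. xs ! j \<in> Gs ! j) \<and>
          (\<forall>i<length Gs. \<forall>j<length Gs. xs ! i \<inter> xs ! j \<noteq> {})}"

definition tuple_degree :: "'a set list \<Rightarrow> nat" where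
  "tuple_degree xs = (\<Sum>j<length xs. simplex_dim (xs ! j))"

definition degree_tuples :: "'a set set list \<Rightarrow> nat \<Rightarrow> 'a set list set" where
  "degree_tuples Gs p = {xs \<in> interacting_tuples Gs. tuple_degree xs = p}"

definition forms :: "'a set set list \<Rightarrow> nat \<Rightarrow> (real, 'a set list \<Rightarrow> real) module" where
  "forms Gs p = ring.func_space class_ring (degree_tuples Gs p)"

definition extend_by_zero ::
  "'a set set list \<Rightarrow> nat \<Rightarrow> ('a set list \<Rightarrow> real) \<Rightarrow> 'a set list \<Rightarrow> real" where
  "extend_by_zero Gs p F xs = (if xs \<in> degree_tuples Gs p then F xs else 0)"

text \<open>The linear extension in slot \<open>j\<close>: the value at \<open>xs\<close> with \<open>xs ! j\<close> replaced by the chain \<open>c\<close>.\<close>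

definition eval_chain ::
  "('a set list \<Rightarrow> real) \<Rightarrow> 'a set list \<Rightarrow> nat \<Rightarrow> ('a set \<Rightarrow>\<^sub>0 int) \<Rightarrow> real" where
  "eval_chain F xs j c =
     (\<Sum>y\<in>Poly_Mapping.keys c. real_of_int (Poly_Mapping.lookup c y) * F (xs[j := y]))"

text \<open>Carriers of \<open>forms\<close> consist of extensional functions, hence the restriction.\<close>

definition exterior_derivative ::
  "('a set \<Rightarrow> 'a list) \<Rightarrow> 'a set set list \<Rightarrow> nat \<Rightarrow> ('a set list \<Rightarrow> real) \<Rightarrow> 'a set list \<Rightarrow> real" where
  "exterior_derivative ori Gs p F =
     (\<lambda>xs \<in> degree_tuples Gs (Suc p).
        \<Sum>j<length Gs. (- 1) ^ (\<Sum>i<j. simplex_dim (xs ! i)) *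
          eval_chain (extend_by_zero Gs p F) xs j (boundary_chain ori (xs ! j)))"

definition cocycles ::
  "('a set \<Rightarrow> 'a list) \<Rightarrow> 'a set set list \<Rightarrow> nat \<Rightarrow> ('a set list \<Rightarrow> real) set" where
  "cocycles ori Gs p =
     {F \<in> carrier (forms Gs p). exterior_derivative ori Gs p F = \<zero>\<^bsub>forms Gs (Suc p)\<^esub>}"

text \<open>There are no forms of degree \<open>-1\<close>, so only zero is a coboundary in degree 0.\<close>

definition coboundaries ::
  "('a set \<Rightarrow> 'a list) \<Rightarrow> 'a set set list \<Rightarrow> nat \<Rightarrow> ('a set list \<Rightarrow> real) set" where
  "coboundaries ori Gs p =
     (case p of
        0 \<Rightarrow> {\<zero>\<^bsub>forms Gs 0\<^esub>}
      | Suc q \<Rightarrow> exterior_derivative ori Gs q ` carrier (forms Gs q))"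

text \<open>The quotient of a module by a submodule \<open>W\<close>. The scalar multiple of a coset is
  \<open>W + c X\<close> rather than \<open>c X\<close>, which would not be a coset for \<open>c = 0\<close>. The fields
  \<open>mult\<close> and \<open>one\<close> of the record play no role in a module.\<close>

definition quotient_module :: "('k, 'v, 'm) module_scheme \<Rightarrow> 'v set \<Rightarrow> ('k, 'v set) module" where
  "quotient_module V W =
     \<lparr>carrier = A_RCOSETS V W,
      mult = (\<lambda>X Y. W),
      one = W,
      zero = W,
      add = set_add V,
      smult = (\<lambda>c X. set_add V W ((\<lambda>x. c \<odot>\<^bsub>V\<^esub> x) ` X))\<rparr>"

definition interaction_cohomology ::
  "('a set \<Rightarrow> 'a list) \<Rightarrow> 'a set set list \<Rightarrow> nat \<Rightarrow> (real, ('a set list \<Rightarrow> real) set) module" where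
  "interaction_cohomology ori Gs p =
     quotient_module ((forms Gs p)\<lparr>carrier := cocycles ori Gs p\<rparr>) (coboundaries ori Gs p)"

definition wu_characteristic :: "nat \<Rightarrow> 'a set set \<Rightarrow> int" where
  "wu_characteristic k G =
     (\<Sum>xs\<in>interacting_tuples (replicate k G). \<Prod>j<k. simplex_sign (xs ! j))"

end

theory Submission
  imports Defs
begin

text \<open>Relative signs of vertex orderings are multiplicative, and moving a vertex past \<open>n\<close> others to
  the front of an ordering contributes the sign \<open>(-1)^n\<close>. Comparing every orientation with one fixed
  enumeration \<open>L\<close> of all vertices therefore writes the coefficient of \<open>x - {v}\<close> in the boundary of
  \<open>x\<close> as \<open>c(x) * c(x - {v}) * (-1)^m\<close>, where \<open>c\<close> takes values \<open>1\<close> and \<open>-1\<close> and \<open>m\<close> is the number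
  of vertices of \<open>x\<close> that precede \<open>v\<close> in \<open>L\<close>. Hence deleting two vertices, from one slot or from two,
  in the two possible orders gives opposite signs, so \<open>d \<circ> d = 0\<close>. With \<open>b\<^sub>p\<close> the dimension of the
  coboundaries in degree \<open>p\<close>, rank-nullity for \<open>d\<close> and for the projection onto cohomology gives
  \<open>dim H\<^sup>p + b\<^sub>p + b\<^bsub>p+1\<^esub> = dim \<Omega>\<^sup>p\<close>. The \<open>b\<^sub>p\<close> cancel in the alternating sum, and \<open>dim \<Omega>\<^sup>p\<close>
  is the number of interacting tuples of degree \<open>p\<close>.\<close>

section \<open>Relative signs and incidence numbers\<close>

lemma permutation_of_list_zip_nth:
  assumes "distinct us" "length us = length vs" "i < length us"
  shows "permutation_of_list (zip us vs) (us ! i) = vs ! i"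
  using assms by (auto intro!: permutation_of_list_unique' simp: in_set_zip)

lemma permutation_of_list_zip_notin:
  assumes "x \<notin> set us"
  shows "permutation_of_list (zip us vs) x = x"
  using assms by (intro permutation_of_list_id) (auto dest: set_zip_leftD)

lemma permutation_zip:
  assumes "distinct us" "distinct vs" "set us = set vs"
  shows "permutation (permutation_of_list (zip us vs))"
proof -
  have "length us = length vs" using assms by (metis distinct_card)
  then have "list_permutes (zip us vs) (set us)"
    using assms by (simp add: list_permutes_def)
  then show ?thesis
    by (meson List.finite_set permutation_of_list_permutes permutes_imp_permutation)
qed

text \<open>Matching entries by index composes, and outside the common vertex set all three maps are
  the identity; \<open>sign\<close> is multiplicative on permutations.\<close>

lemma relative_sign_trans:
  assumes "distinct us" "distinct vs" "distinct ws" "set us = set vs" "set vs = set ws"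
  shows "relative_sign us vs * relative_sign vs ws = relative_sign us ws"
proof -
  have len: "length us = length vs" "length vs = length ws"
    using assms by (metis distinct_card)+
  have "permutation_of_list (zip vs ws) \<circ> permutation_of_list (zip us vs) = permutation_of_list (zip us ws)"
  proof
    fix x
    show "(permutation_of_list (zip vs ws) \<circ> permutation_of_list (zip us vs)) x =
        permutation_of_list (zip us ws) x"
    proof (cases "x \<in> set us")
      case True
      then obtain i where "i < length us" "x = us ! i" by (auto simp: in_set_conv_nth)
      then show ?thesis using assms len by (simp add: permutation_of_list_zip_nth)
    next
      case False
      then show ?thesis using assms by (simp add: permutation_of_list_zip_notin)
    qed
  qed
  then show ?thesis
    unfolding relative_sign_def
    by (metis (no_types) assms mult.commute permutation_zip sign_compose)
qed

lemma relative_sign_square [simp]: "relative_sign us vs * relative_sign us vs = 1"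
  by (simp add: relative_sign_def)

lemma relative_sign_Cons:
  assumes "v \<notin> set us"
  shows "relative_sign (v # us) (v # vs) = relative_sign us vs"
proof -
  have "permutation_of_list (zip (v # us) (v # vs)) = permutation_of_list (zip us vs)"
    using assms by (auto simp: fun_eq_iff permutation_of_list_Cons permutation_of_list_zip_notin)
  then show ?thesis by (simp add: relative_sign_def)
qed

lemma relative_sign_self:
  assumes "distinct us"
  shows "relative_sign us us = 1"
  using relative_sign_trans[OF assms assms assms refl refl] unfolding relative_sign_square
  by (rule sym)

text \<open>By multiplicativity the two signs are inverse to each other, and a sign is its own
  inverse.\<close>

lemma relative_sign_commute:
  assumes "distinct us" "distinct vs" "set us = set vs"
  shows "relative_sign us vs = relative_sign vs us"
proof -
  have "relative_sign us vs = relative_sign us vs * (relative_sign vs us * relative_sign vs us)" by simp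
  also have "\<dots> = relative_sign us us * relative_sign vs us"
    unfolding relative_sign_trans[OF assms(1,2,1) assms(3) assms(3)[symmetric], symmetric]
    by (rule mult.assoc[symmetric])
  also have "\<dots> = relative_sign vs us"
    unfolding relative_sign_self[OF assms(1)] by (rule mult_1_left)
  finally show ?thesis .
qed

text \<open>The permutation in question is the transposition of \<open>a\<close> and
  \<open>b\<close>.\<close>

lemma relative_sign_swap:
  assumes "distinct (a # b # us)"
  shows "relative_sign (a # b # us) (b # a # us) = - 1"
proof -
  have "permutation_of_list (zip us us) x = x" for x
  proof (cases "x \<in> set us")
    case True
    then obtain i where "i < length us" "x = us ! i" by (auto simp: in_set_conv_nth)
    then show ?thesis using assms by (simp add: permutation_of_list_zip_nth)
  qed (simp add: permutation_of_list_zip_notin)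
  then have "permutation_of_list (zip (a # b # us) (b # a # us)) = Transposition.transpose a b"
    by (auto simp: fun_eq_iff permutation_of_list_Cons Transposition.transpose_def)
  then show ?thesis using assms by (simp add: relative_sign_def sign_swap_id)
qed

text \<open>Induction on the prefix: \<open>v\<close> first moves to the front of the tail behind
  \<open>a\<close>, then trades places with \<open>a\<close>, which costs one factor -1.\<close>

lemma relative_sign_move_to_front:
  assumes "distinct (us @ v # vs)"
  shows "relative_sign (us @ v # vs) (v # us @ vs) = (- 1) ^ length us"
  using assms
proof (induction us)
  case Nil
  then show ?case by (simp add: relative_sign_self)
next
  case (Cons a us)
  have "relative_sign ((a # us) @ v # vs) (v # (a # us) @ vs) =
      relative_sign (a # (us @ v # vs)) (a # (v # us @ vs)) * relative_sign (a # v # us @ vs) (v # a # us @ vs)"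
    using Cons.prems by (subst relative_sign_trans) auto
  also have "\<dots> = (- 1) ^ length us * (- 1)"
    using Cons by (subst relative_sign_Cons, force, subst relative_sign_swap) auto
  finally show ?case by simp
qed

section \<open>Signs of vertex positions in a fixed enumeration\<close>

definition restrict_order :: "'a list \<Rightarrow> 'a set \<Rightarrow> 'a list" where
  "restrict_order L x = filter (\<lambda>v. v \<in> x) L"

definition predecessors :: "'a list \<Rightarrow> 'a \<Rightarrow> 'a set" where
  "predecessors L v = set (takeWhile (\<lambda>u. u \<noteq> v) L)"

text \<open>For distinct \<open>L\<close> and \<open>v\<close> in \<open>x\<close>, with
  \<open>x\<close> inside \<open>set L\<close>, the exponent is the zero-based index of
  \<open>v\<close> in \<open>restrict_order L x\<close>. This is the usual boundary sign for the
  ordering induced by \<open>L\<close>.\<close>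

definition position_sign :: "'a list \<Rightarrow> 'a set \<Rightarrow> 'a \<Rightarrow> int" where
  "position_sign L x v = (- 1) ^ card (x \<inter> predecessors L v)"

lemma restrict_order_props:
  assumes "distinct L" "x \<subseteq> set L"
  shows "distinct (restrict_order L x)" "set (restrict_order L x) = x"
  using assms by (auto simp: restrict_order_def)

text \<open>To reach the front, \<open>v\<close> passes exactly those vertices of \<open>x\<close>
  that precede it in \<open>L\<close>.\<close>

lemma relative_sign_restrict_order:
  assumes "distinct L" "x \<subseteq> set L" "v \<in> x"
  shows "relative_sign (restrict_order L x) (v # restrict_order L (x - {v})) = position_sign L x v"
proof -
  obtain P Q where L: "L = P @ v # Q" "v \<notin> set P"
    using assms by (meson in_mono split_list_first)
  then have vQ: "v \<notin> set Q" "distinct P" using assms(1) by auto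
  have pred: "predecessors L v = set P"
    using L by (simp add: predecessors_def takeWhile_append takeWhile_eq_all_conv)
  have f: "filter (\<lambda>u. u \<in> x \<and> u \<noteq> v) P = filter (\<lambda>u. u \<in> x) P"
    "filter (\<lambda>u. u \<in> x \<and> u \<noteq> v) Q = filter (\<lambda>u. u \<in> x) Q"
    using L vQ by (auto intro!: filter_cong)
  have "length (filter (\<lambda>u. u \<in> x) P) = card (x \<inter> set P)"
    using vQ by (metis distinct_card distinct_filter Int_commute set_filter Int_def Collect_conj_eq Collect_mem_eq)
  moreover have "restrict_order L x = filter (\<lambda>u. u \<in> x) P @ v # filter (\<lambda>u. u \<in> x) Q"
    using assms L by (simp add: restrict_order_def)
  moreover have "restrict_order L (x - {v}) = filter (\<lambda>u. u \<in> x) P @ filter (\<lambda>u. u \<in> x) Q"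
    by (simp add: restrict_order_def L f)
  moreover have "distinct (restrict_order L x)" using assms by (simp add: restrict_order_def)
  ultimately show ?thesis
    by (simp add: relative_sign_move_to_front position_sign_def pred)
qed

lemma predecessors_cases:
  assumes "v \<in> set L" "w \<in> set L" "v \<noteq> w"
  shows "w \<in> predecessors L v \<longleftrightarrow> v \<notin> predecessors L w"
  using assms by (induction L) (auto simp: predecessors_def)

lemma position_sign_minus:
  assumes "finite x" "w \<in> x"
  shows "position_sign L x v = (if w \<in> predecessors L v then -1 else 1) * position_sign L (x - {w}) v"
proof (cases "w \<in> predecessors L v")
  case True
  have "(x - {w}) \<inter> predecessors L v = x \<inter> predecessors L v - {w}" by auto
  moreover have "card (x \<inter> predecessors L v) = Suc (card (x \<inter> predecessors L v - {w}))"
    using assms True by (intro card.remove) auto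
  ultimately show ?thesis using True by (simp add: position_sign_def)
next
  case False
  then have "(x - {w}) \<inter> predecessors L v = x \<inter> predecessors L v" by auto
  then show ?thesis using False by (simp add: position_sign_def)
qed

text \<open>Deleting one vertex shifts the position of the other only if it comes earlier in
  \<open>L\<close>. Exactly one of the two is earlier, so exactly one side picks up an extra
  -1.\<close>

lemma position_sign_anticommute:
  assumes "finite x" "x \<subseteq> set L" "v \<in> x" "w \<in> x" "v \<noteq> w"
  shows "position_sign L x v * position_sign L (x - {v}) w =
    - (position_sign L x w * position_sign L (x - {w}) v)"
proof -
  have "v \<in> predecessors L w \<longleftrightarrow> w \<notin> predecessors L v"
    using assms predecessors_cases[of v L w] by blast
  then show ?thesis
    using position_sign_minus[OF assms(1,4), of L v] position_sign_minus[OF assms(1,3), of L w] by simp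
qed

text \<open>The left side is the boundary coefficient with respect to arbitrary orientations. The
  ordering \<open>u\<close> is carried to \<open>?r\<close> through \<open>v # us @ vs\<close> and
  \<open>v # ?s\<close>; the resulting product of signs is then solved for the left side, since
  every factor squares to 1.\<close>

lemma relative_sign_delete:
  assumes "distinct L" "set u \<subseteq> set L" "distinct u" "u = us @ v # vs"
    and "distinct w" "set w = set u - {v}"
  shows "(- 1) ^ length us * relative_sign (us @ vs) w =
    relative_sign u (restrict_order L (set u)) * relative_sign w (restrict_order L (set w)) *
    position_sign L (set u) v"
proof -
  let ?r = "restrict_order L (set u)" and ?s = "restrict_order L (set w)"
  have r: "distinct ?r" "set ?r = set u" and s: "distinct ?s" "set ?s = set w"
    using assms by (intro restrict_order_props; auto)+
  have sets: "set (us @ vs) = set w" "v \<notin> set (us @ vs)" "v \<notin> set w" using assms by auto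
  have "relative_sign u ?r = relative_sign u (v # us @ vs) * relative_sign (v # us @ vs) ?r"
    using assms r by (subst relative_sign_trans) auto
  also have "relative_sign (v # us @ vs) ?r = relative_sign (v # us @ vs) (v # ?s) * relative_sign (v # ?s) ?r"
    using assms r s by (subst relative_sign_trans) auto
  also have "relative_sign u (v # us @ vs) = (- 1) ^ length us"
    using assms relative_sign_move_to_front by simp
  also have "relative_sign (v # us @ vs) (v # ?s) = relative_sign (us @ vs) ?s"
    using sets by (intro relative_sign_Cons) auto
  also have "\<dots> = relative_sign (us @ vs) w * relative_sign w ?s"
    using assms s sets by (subst relative_sign_trans) auto
  also have "relative_sign (v # ?s) ?r = relative_sign ?r (v # ?s)"
    using r s assms by (intro relative_sign_commute) auto
  also have "\<dots> = position_sign L (set u) v"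
    using relative_sign_restrict_order[of L "set u" v] assms by simp
  finally have 1: "relative_sign u ?r =
      (- 1) ^ length us * (relative_sign (us @ vs) w * relative_sign w ?s * position_sign L (set u) v)" .
  have "position_sign L (set u) v * position_sign L (set u) v = 1"
    by (simp add: position_sign_def flip: power_add mult_2)
  then show ?thesis unfolding 1 using relative_sign_square[of w ?s]
    by (simp add: mult_ac)
qed

section \<open>Incidence numbers and the boundary chain\<close>

definition orientation_sign :: "'a list \<Rightarrow> ('a set \<Rightarrow> 'a list) \<Rightarrow> 'a set \<Rightarrow> int" where
  "orientation_sign L ori x = relative_sign (ori x) (restrict_order L x)"

text \<open>This is the matrix entry of the boundary map: the entry for the ordering
  \<open>L\<close>, conjugated by the diagonal change of basis to the chosen orientations.\<close>

definition incidence :: "'a list \<Rightarrow> ('a set \<Rightarrow> 'a list) \<Rightarrow> 'a set \<Rightarrow> 'a \<Rightarrow> int" where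
  "incidence L ori x v =
     orientation_sign L ori x * orientation_sign L ori (x - {v}) * position_sign L x v"

lemma incidence_anticommute:
  assumes "finite x" "x \<subseteq> set L" "v \<in> x" "w \<in> x" "v \<noteq> w"
  shows "incidence L ori x v * incidence L ori (x - {v}) w =
    - (incidence L ori x w * incidence L ori (x - {w}) v)"
proof -
  define o' where "o' = orientation_sign L ori"
  \<comment> \<open>This holds for every \<open>y\<close>, including the empty set, because
    \<open>relative_sign\<close> is 1 or -1 on all lists. It removes the sign of the intermediate
    face.\<close>
  have cancel: "o' y * (o' y * n) = n" for y n
    using relative_sign_square[of "ori y" "restrict_order L y"]
    by (simp add: o'_def orientation_sign_def flip: mult.assoc)
  have eq: "incidence L ori x v * incidence L ori (x - {v}) w =
      o' x * o' (x - {v, w}) * (position_sign L x v * position_sign L (x - {v}) w)" for v w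
    unfolding incidence_def o'_def[symmetric] Diff_insert2[symmetric] by (simp only: mult_ac cancel)
  show ?thesis
    unfolding eq position_sign_anticommute[OF assms] insert_commute[of v w] by simp
qed

text \<open>The \<open>i\<close>-th summand of the definition belongs to the \<open>i\<close>-th
  vertex of \<open>ori x\<close>; reindexing by vertices turns the sum over positions into a sum
  over \<open>x\<close>.\<close>

lemma boundary_chain_eq:
  assumes G: "finite_simplicial_complex G" "orientation_of G ori"
    and L: "distinct L" "\<Union>G \<subseteq> set L" and x: "x \<in> G" "card x \<ge> 2"
  shows "boundary_chain ori x = (\<Sum>v\<in>x. frag_cmul (incidence L ori x v) (frag_of (x - {v})))"
proof -
  let ?u = "ori x"
  have u: "distinct ?u" "set ?u = x" using G x by (auto simp: orientation_of_def)
  have len: "length ?u = card x" using u distinct_card by fastforce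
  have "frag_cmul ((- 1) ^ i) (oriented_chain ori (take i ?u @ drop (Suc i) ?u)) =
      frag_cmul (incidence L ori x (?u ! i)) (frag_of (x - {?u ! i}))" if i: "i < card x" for i
  proof -
    have split: "?u = take i ?u @ ?u ! i # drop (Suc i) ?u" using i len by (simp add: id_take_nth_drop)
    then have "distinct (take i ?u @ ?u ! i # drop (Suc i) ?u)" using u by simp
    moreover have "set (take i ?u @ ?u ! i # drop (Suc i) ?u) = x" using u split by simp
    ultimately have face: "set (take i ?u @ drop (Suc i) ?u) = x - {?u ! i}" by auto
    \<comment> \<open>With at least two vertices in \<open>x\<close> the face is nonempty, hence
      lies in \<open>G\<close> and carries an orientation.\<close>
    have "card (x - {?u ! i}) \<noteq> 0" using x i len u by (metis One_nat_def card_Diff_singleton diff_is_0_eq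
       nth_mem not_less_eq_eq numeral_2_eq_2)
    then have "x - {?u ! i} \<in> G" using G x unfolding finite_simplicial_complex_def by (metis Diff_subset card.empty)
    then have "distinct (ori (x - {?u ! i}))" "set (ori (x - {?u ! i})) = x - {?u ! i}"
      using G by (auto simp: orientation_of_def)
    then have "(- 1) ^ i * relative_sign (take i ?u @ drop (Suc i) ?u) (ori (x - {?u ! i})) =
        incidence L ori x (?u ! i)"
      using relative_sign_delete[of L ?u "take i ?u" "?u ! i" "drop (Suc i) ?u" "ori (x - {?u ! i})"]
        u L x split i len by (auto simp: incidence_def orientation_sign_def)
    then show ?thesis unfolding oriented_chain_def face by simp
  qed
  moreover have "{..simplex_dim x} = {..<card x}" using x by (auto simp: simplex_dim_def)
  moreover have "bij_betw ((!) ?u) {..<card x} x"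
    using bij_betw_nth[OF u(1), of "{..<card x}" x] u len by simp
  ultimately show ?thesis
    using x sum.reindex_bij_betw[of "(!) ?u" "{..<card x}" x
      "\<lambda>v. frag_cmul (incidence L ori x v) (frag_of (x - {v}))"]
    by (simp add: boundary_chain_def simplex_dim_def)
qed

text \<open>The condition on \<open>F\<close> covers the case of a single vertex: there the boundary
  is 0 by definition, whereas the right side evaluates \<open>F\<close> at the empty set.\<close>

lemma eval_chain_boundary:
  assumes G: "finite_simplicial_complex G" "orientation_of G ori"
    and L: "distinct L" "\<Union>G \<subseteq> set L" and x: "x \<in> G"
    and F: "F (xs[j := {}]) = 0"
  shows "eval_chain F xs j (boundary_chain ori x) =
    (\<Sum>v\<in>x. real_of_int (incidence L ori x v) * F (xs[j := x - {v}]))"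
proof (cases "card x \<ge> 2")
  case True
  have fin: "finite x" using G x by (auto simp: finite_simplicial_complex_def)
  have b: "boundary_chain ori x = (\<Sum>v\<in>x. frag_cmul (incidence L ori x v) (frag_of (x - {v})))"
    using boundary_chain_eq[OF G L x True] .
  have lookup: "Poly_Mapping.lookup (boundary_chain ori x) (x - {v}) = incidence L ori x v" if "v \<in> x" for v
  proof -
    have "Poly_Mapping.lookup (boundary_chain ori x) (x - {v}) =
        (\<Sum>w\<in>x. if w = v then incidence L ori x w else 0)"
      unfolding b lookup_sum using that by (intro sum.cong) (auto simp: lookup_single when_def)
    then show ?thesis using fin that by simp
  qed
  have "Poly_Mapping.keys (boundary_chain ori x) \<subseteq> (\<lambda>v. x - {v}) ` x"
  proof
    fix y assume "y \<in> Poly_Mapping.keys (boundary_chain ori x)"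
    then have "y \<in> (\<Union>v\<in>x. Poly_Mapping.keys (frag_cmul (incidence L ori x v) (frag_of (x - {v}))))"
      unfolding b by (rule subsetD[OF keys_sum])
    then show "y \<in> (\<lambda>v. x - {v}) ` x" by auto
  qed
  \<comment> \<open>Faces outside the keys have coefficient 0, so the sum may run over all
    faces.\<close>
  then have "eval_chain F xs j (boundary_chain ori x) =
      (\<Sum>y\<in>(\<lambda>v. x - {v}) ` x. real_of_int (Poly_Mapping.lookup (boundary_chain ori x) y) * F (xs[j := y]))"
    unfolding eval_chain_def using fin by (intro sum.mono_neutral_left) (auto simp: in_keys_iff)
  also have "\<dots> = (\<Sum>v\<in>x. real_of_int (incidence L ori x v) * F (xs[j := x - {v}]))"
    by (subst sum.reindex) (auto simp: inj_on_def lookup)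
  finally show ?thesis .
next
  case False
  moreover have "card x \<noteq> 0" using G x by (auto simp: finite_simplicial_complex_def)
  ultimately have "card x = 1" by simp
  then obtain v where "x = {v}" by (auto simp: card_1_singleton_iff)
  then show ?thesis using F by (simp add: eval_chain_def boundary_chain_def simplex_dim_def)
qed

section \<open>The exterior derivative squares to zero\<close>

lemma antisymmetric_double_sum:
  fixes S :: "'b \<Rightarrow> 'b \<Rightarrow> real"
  assumes "\<And>i j. i \<in> A \<Longrightarrow> j \<in> A \<Longrightarrow> S i j = - S j i"
  shows "(\<Sum>i\<in>A. \<Sum>j\<in>A. S i j) = 0"
proof -
  have "(\<Sum>i\<in>A. \<Sum>j\<in>A. S i j) = (\<Sum>i\<in>A. \<Sum>j\<in>A. - S j i)"
    by (intro sum.cong refl assms)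
  also have "\<dots> = - (\<Sum>j\<in>A. \<Sum>i\<in>A. S i j)" by (simp add: sum_negf)
  also have "(\<Sum>j\<in>A. \<Sum>i\<in>A. S i j) = (\<Sum>i\<in>A. \<Sum>j\<in>A. S i j)" by (rule sum.swap)
  finally show ?thesis by simp
qed

definition slot_sign :: "'a set list \<Rightarrow> nat \<Rightarrow> real" where
  "slot_sign xs j = (- 1) ^ (\<Sum>i<j. simplex_dim (xs ! i))"

lemma slot_sign_update_ge:
  assumes "l \<le> j"
  shows "slot_sign (xs[j := y]) l = slot_sign xs l"
  unfolding slot_sign_def using assms by (intro arg_cong2[of _ _ _ _ "(^)"] sum.cong) auto

lemma slot_sign_update_less:
  assumes "j < l" "j < length xs" "Suc (simplex_dim y) = simplex_dim (xs ! j)"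
  shows "slot_sign (xs[j := y]) l = - slot_sign xs l"
proof -
  have "(\<Sum>i<l. simplex_dim (xs ! i)) = simplex_dim (xs ! j) + (\<Sum>i\<in>{..<l} - {j}. simplex_dim (xs ! i))"
    using assms by (intro sum.remove) auto
  moreover have "(\<Sum>i<l. simplex_dim (xs[j := y] ! i)) =
      simplex_dim (xs[j := y] ! j) + (\<Sum>i\<in>{..<l} - {j}. simplex_dim (xs[j := y] ! i))"
    using assms by (intro sum.remove) auto
  moreover have "(\<Sum>i\<in>{..<l} - {j}. simplex_dim (xs[j := y] ! i)) =
      (\<Sum>i\<in>{..<l} - {j}. simplex_dim (xs ! i))" by (intro sum.cong) auto
  ultimately have "(\<Sum>i<l. simplex_dim (xs ! i)) = Suc (\<Sum>i<l. simplex_dim (xs[j := y] ! i))"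
    using assms by simp
  then show ?thesis by (simp add: slot_sign_def)
qed

text \<open>Nonemptiness matters: by truncated subtraction the empty set has
  \<open>simplex_dim\<close> 0, the same as a vertex.\<close>

lemma simplex_dim_remove:
  assumes "finite x" "v \<in> x" "x - {v} \<noteq> {}"
  shows "Suc (simplex_dim (x - {v})) = simplex_dim x"
proof -
  have "card (x - {v}) \<noteq> 0" using assms by (simp only: card_0_eq finite_Diff not_False_eq_True)
  moreover have "card x = Suc (card (x - {v}))" using assms by (intro card.remove)
  ultimately show ?thesis by (simp add: simplex_dim_def)
qed

definition remove_at :: "'a set list \<Rightarrow> nat \<Rightarrow> 'a \<Rightarrow> 'a set list" where
  "remove_at xs j v = xs[j := xs ! j - {v}]"

text \<open>The formula for the derivative on arbitrary tuples, with no condition on interaction or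
  degree, so that it can be iterated freely.\<close>

definition unrestricted_derivative ::
  "'a list \<Rightarrow> ('a set \<Rightarrow> 'a list) \<Rightarrow> nat \<Rightarrow> ('a set list \<Rightarrow> real) \<Rightarrow> 'a set list \<Rightarrow> real" where
  "unrestricted_derivative L ori k F xs =
     (\<Sum>j<k. slot_sign xs j * (\<Sum>v\<in>xs ! j. real_of_int (incidence L ori (xs ! j) v) * F (remove_at xs j v)))"

text \<open>Each double deletion occurs in two orders with opposite signs. Within one slot the
  incidence numbers anticommute. For two slots the incidence numbers agree, but deleting from the
  earlier slot first flips the sign of the later one.\<close>

lemma unrestricted_derivative_twice:
  assumes len: "length xs = k"
    and xs: "\<And>j. j < k \<Longrightarrow> finite (xs ! j) \<and> xs ! j \<subseteq> set L"
    and F: "\<And>ys j. length ys = k \<Longrightarrow> j < k \<Longrightarrow> ys ! j = {} \<Longrightarrow> F ys = 0"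
  shows "unrestricted_derivative L ori k (unrestricted_derivative L ori k F) xs = 0"
proof -
  \<comment> \<open>The contribution of deleting \<open>v\<close> from slot \<open>j\<close> first
    and \<open>w\<close> from slot \<open>l\<close> second.\<close>
  define T where "T j v l w = slot_sign xs j * slot_sign (remove_at xs j v) l *
      (real_of_int (incidence L ori (xs ! j) v) * real_of_int (incidence L ori (remove_at xs j v ! l) w)) *
      F (remove_at (remove_at xs j v) l w)" for j v l w
  define S where "S j l = (\<Sum>v\<in>xs ! j. \<Sum>w\<in>remove_at xs j v ! l. T j v l w)" for j l
  have "unrestricted_derivative L ori k (unrestricted_derivative L ori k F) xs =
      (\<Sum>j<k. \<Sum>v\<in>xs ! j. \<Sum>l<k. \<Sum>w\<in>remove_at xs j v ! l. T j v l w)"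
    unfolding unrestricted_derivative_def T_def by (simp add: sum_distrib_left mult_ac)
  also have "\<dots> = (\<Sum>j<k. \<Sum>l<k. S j l)"
    unfolding S_def by (intro sum.cong refl sum.swap)
  also have "\<dots> = 0"
  proof (rule antisymmetric_double_sum)
    fix j l assume "j \<in> {..<k}" "l \<in> {..<k}"
    then have j: "j < k" "finite (xs ! j)" "xs ! j \<subseteq> set L"
      and l: "l < k" "finite (xs ! l)" "xs ! l \<subseteq> set L" using xs by auto
    show "S j l = - S l j"
    proof (cases "j = l")
      case True
      \<comment> \<open>The second vertex ranges over \<open>xs ! j - {v}\<close>, which depends on
        the first. Extending by 0 on the diagonal makes both ranges equal to \<open>xs ! j\<close>,
        as \<open>antisymmetric_double_sum\<close> requires.\<close>
      define U where "U v w = (if v = w then 0 else T j v j w)" for v w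
      have slot: "remove_at xs j v ! j = xs ! j - {v}" for v
        using j len by (simp add: remove_at_def)
      have "S j j = (\<Sum>v\<in>xs ! j. \<Sum>w\<in>xs ! j. U v w)"
        unfolding S_def slot
      proof (rule sum.cong[OF refl])
        fix v assume "v \<in> xs ! j"
        show "(\<Sum>w\<in>xs ! j - {v}. T j v j w) = (\<Sum>w\<in>xs ! j. U v w)"
          using j by (intro sum.mono_neutral_cong_left) (auto simp: U_def)
      qed
      also have "\<dots> = 0"
      proof (rule antisymmetric_double_sum)
        fix v w assume vw: "v \<in> xs ! j" "w \<in> xs ! j"
        show "U v w = - U w v"
        proof (cases "v = w")
          case False
          have "xs ! j - {v} - {w} = xs ! j - {w} - {v}" by auto
          then have "remove_at (remove_at xs j v) j w = remove_at (remove_at xs j w) j v"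
            using j len by (simp add: remove_at_def)
          moreover have "slot_sign (remove_at xs j v) j = slot_sign (remove_at xs j w) j"
            by (simp add: remove_at_def slot_sign_update_ge)
          moreover have "real_of_int (incidence L ori (xs ! j) v) * real_of_int (incidence L ori (xs ! j - {v}) w) =
              - (real_of_int (incidence L ori (xs ! j) w) * real_of_int (incidence L ori (xs ! j - {w}) v))"
            using incidence_anticommute[OF j(2,3) vw False, of ori]
            by (metis of_int_minus of_int_mult)
          ultimately show ?thesis using False by (simp add: U_def T_def slot)
        qed (simp add: U_def)
      qed
      finally show ?thesis using True by simp
    next
      case False
      have slot: "remove_at xs j v ! l = xs ! l" "remove_at xs l v ! j = xs ! j" for v
        using False by (simp_all add: remove_at_def)
      have "T j v l w = - T l w j v" if v: "v \<in> xs ! j" and w: "w \<in> xs ! l" for v w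
      proof -
        have comm: "remove_at (remove_at xs j v) l w = remove_at (remove_at xs l w) j v"
          using False len j l by (simp add: remove_at_def list_update_swap)
        show ?thesis
        proof (cases "xs ! j - {v} = {} \<or> xs ! l - {w} = {}")
          \<comment> \<open>If a deletion empties a slot, the dimension does not drop and the sign
            rule fails, but \<open>F\<close> vanishes on the resulting tuple.\<close>
          case True
          have "remove_at (remove_at xs j v) l w ! j = xs ! j - {v}"
            "remove_at (remove_at xs j v) l w ! l = xs ! l - {w}"
            "length (remove_at (remove_at xs j v) l w) = k"
            using False len j l by (simp_all add: remove_at_def)
          then have "F (remove_at (remove_at xs j v) l w) = 0"
            using True F j l by metis
          then show ?thesis using comm by (simp add: T_def)
        next
          case nonempty: False
          have sgn: "slot_sign xs j * slot_sign (remove_at xs j v) l =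
              - (slot_sign xs l * slot_sign (remove_at xs l w) j)"
          proof (cases "j < l")
            case True
            then have "slot_sign (remove_at xs j v) l = - slot_sign xs l"
              using nonempty v j len unfolding remove_at_def
              by (intro slot_sign_update_less simplex_dim_remove) auto
            then show ?thesis using True by (simp add: remove_at_def slot_sign_update_ge)
          next
            case False
            then have "l < j" using \<open>j \<noteq> l\<close> by simp
            then have "slot_sign (remove_at xs l w) j = - slot_sign xs j"
              using nonempty w l len unfolding remove_at_def
              by (intro slot_sign_update_less simplex_dim_remove) auto
            then show ?thesis using \<open>l < j\<close> by (simp add: remove_at_def slot_sign_update_ge)
          qed
          show ?thesis unfolding T_def slot comm sgn by simp
        qed
      qed
      then have "S j l = (\<Sum>v\<in>xs ! j. \<Sum>w\<in>xs ! l. - T l w j v)"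
        unfolding S_def slot by (intro sum.cong) auto
      also have "\<dots> = - S l j"
        unfolding S_def slot by (subst sum.swap) (simp add: sum_negf)
      finally show ?thesis .
    qed
  qed
  finally show ?thesis .
qed

text \<open>Enlarging the entries keeps intersections nonempty. In contrapositive form, deleting
  vertices cannot make a tuple of simplices interact.\<close>

lemma interacting_tuples_superset:
  assumes "zs \<in> interacting_tuples Gs" "length ys = length Gs"
    and "\<And>i. i < length Gs \<Longrightarrow> zs ! i \<subseteq> ys ! i"
    and "\<And>i. i < length Gs \<Longrightarrow> ys ! i \<in> Gs ! i"
  shows "ys \<in> interacting_tuples Gs"
proof -
  have "ys ! i \<inter> ys ! j \<noteq> {}" if "i < length Gs" "j < length Gs" for i j
    using assms(1) assms(3)[OF that(1)] assms(3)[OF that(2)] that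
    unfolding interacting_tuples_def by blast
  then show ?thesis using assms by (auto simp: interacting_tuples_def)
qed

section \<open>The exterior derivative on interacting tuples\<close>

locale oriented_complexes =
  fixes Gs :: "'a set set list" and ori :: "'a set \<Rightarrow> 'a list" and L :: "'a list"
  assumes complex: "\<And>G. G \<in> set Gs \<Longrightarrow> finite_simplicial_complex G"
    and orientation: "\<And>G. G \<in> set Gs \<Longrightarrow> orientation_of G ori"
    and distinct_L: "distinct L"
    and vertices_L: "\<And>G. G \<in> set Gs \<Longrightarrow> \<Union>G \<subseteq> set L"
begin

text \<open>An interacting tuple has no empty entry, since each entry must meet itself.\<close>

lemma extend_by_zero_empty:
  assumes "length ys = length Gs" "j < length Gs" "ys ! j = {}"
  shows "extend_by_zero Gs p F ys = 0"
proof -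
  have "ys \<notin> interacting_tuples Gs"
    using assms unfolding interacting_tuples_def by blast
  then show ?thesis by (simp add: extend_by_zero_def degree_tuples_def)
qed

lemma exterior_derivative_eq:
  assumes "xs \<in> degree_tuples Gs (Suc p)"
  shows "exterior_derivative ori Gs p F xs =
    unrestricted_derivative L ori (length Gs) (extend_by_zero Gs p F) xs"
proof -
  have xs: "length xs = length Gs" "\<And>j. j < length Gs \<Longrightarrow> xs ! j \<in> Gs ! j"
    using assms by (auto simp: degree_tuples_def interacting_tuples_def)
  have "eval_chain (extend_by_zero Gs p F) xs j (boundary_chain ori (xs ! j)) =
      (\<Sum>v\<in>xs ! j. real_of_int (incidence L ori (xs ! j) v) * extend_by_zero Gs p F (remove_at xs j v))"
    if "j < length Gs" for j
    unfolding remove_at_def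
  proof (rule eval_chain_boundary)
    have "Gs ! j \<in> set Gs" using that by simp
    then show "finite_simplicial_complex (Gs ! j)" "orientation_of (Gs ! j) ori" "\<Union>(Gs ! j) \<subseteq> set L"
      by (fact complex orientation vertices_L)+
    show "extend_by_zero Gs p F (xs[j := {}]) = 0"
      using that xs by (intro extend_by_zero_empty[of _ j]) auto
  qed (use distinct_L xs that in auto)
  then show ?thesis
    using assms by (simp add: exterior_derivative_def unrestricted_derivative_def slot_sign_def)
qed

text \<open>This allows the second derivative to be computed by the unrestricted formula. If
  \<open>remove_at xs j v\<close> leaves the domain of forms, the left side is 0 by extension, and
  so is every term on the right, because a further deletion cannot restore interaction.\<close>

lemma extend_by_zero_exterior_derivative:
  assumes xs: "xs \<in> degree_tuples Gs (Suc (Suc p))" and j: "j < length Gs" and v: "v \<in> xs ! j"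
  shows "extend_by_zero Gs (Suc p) (exterior_derivative ori Gs p F) (remove_at xs j v) =
    unrestricted_derivative L ori (length Gs) (extend_by_zero Gs p F) (remove_at xs j v)"
proof (cases "remove_at xs j v \<in> degree_tuples Gs (Suc p)")
  case True
  then show ?thesis by (simp add: extend_by_zero_def exterior_derivative_eq)
next
  case False
  let ?ys = "remove_at xs j v"
  have mem: "length xs = length Gs" "\<And>j. j < length Gs \<Longrightarrow> xs ! j \<in> Gs ! j"
    and deg: "tuple_degree xs = Suc (Suc p)"
    using xs by (auto simp: degree_tuples_def interacting_tuples_def)
  have fsc: "finite_simplicial_complex (Gs ! i)" if "i < length Gs" for i
    using that by (simp add: complex)
  have fin: "finite (xs ! j)" using fsc[OF j] mem(2)[OF j] by (simp add: finite_simplicial_complex_def)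
  \<comment> \<open>The degree cannot be what fails: an interacting result has a nonempty slot
    \<open>j\<close>, so its degree has dropped to exactly \<open>Suc p\<close>.\<close>
  have not_interacting: "?ys \<notin> interacting_tuples Gs"
  proof
    assume ys: "?ys \<in> interacting_tuples Gs"
    then have "?ys ! j \<noteq> {}" using j unfolding interacting_tuples_def by blast
    then have "Suc (simplex_dim (?ys ! j)) = simplex_dim (xs ! j)"
      using simplex_dim_remove[OF fin v] j mem by (simp add: remove_at_def)
    moreover have "tuple_degree xs = simplex_dim (xs ! j) + (\<Sum>i\<in>{..<length Gs} - {j}. simplex_dim (xs ! i))"
      unfolding tuple_degree_def mem(1) using j by (intro sum.remove) auto
    moreover have "tuple_degree ?ys = simplex_dim (?ys ! j) + (\<Sum>i\<in>{..<length Gs} - {j}. simplex_dim (?ys ! i))"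
      unfolding tuple_degree_def using j mem(1) by (subst sum.remove[of _ j]) (auto simp: remove_at_def)
    moreover have "(\<Sum>i\<in>{..<length Gs} - {j}. simplex_dim (?ys ! i)) =
        (\<Sum>i\<in>{..<length Gs} - {j}. simplex_dim (xs ! i))"
      by (intro sum.cong) (auto simp: remove_at_def)
    ultimately have "tuple_degree ?ys = Suc p" using deg by simp
    then show False using False ys by (simp add: degree_tuples_def)
  qed
  have "extend_by_zero Gs p F (remove_at ?ys l w) = 0" if l: "l < length Gs" for l w
  proof -
    have "remove_at ?ys l w \<notin> interacting_tuples Gs"
    proof
      assume zs: "remove_at ?ys l w \<in> interacting_tuples Gs"
      have sub: "remove_at ?ys l w ! i \<subseteq> ?ys ! i" "?ys ! i \<subseteq> xs ! i" if "i < length Gs" for i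
        using that mem(1) j l by (auto simp: remove_at_def nth_list_update)
      have "?ys ! i \<in> Gs ! i" if i: "i < length Gs" for i
      proof -
        \<comment> \<open>If the smaller tuple interacted, each entry of \<open>?ys\<close> would
          contain a nonempty set and lie in a simplex, hence be a simplex itself.\<close>
        have "remove_at ?ys l w ! i \<noteq> {}" using zs i unfolding interacting_tuples_def by blast
        then show ?thesis
          using sub[OF i] mem(2)[OF i] fsc[OF i] unfolding finite_simplicial_complex_def by blast
      qed
      then have "?ys \<in> interacting_tuples Gs"
        using interacting_tuples_superset[OF zs _ sub(1)] mem(1) by (simp add: remove_at_def)
      then show False using not_interacting by simp
    qed
    then show ?thesis by (simp add: extend_by_zero_def degree_tuples_def)
  qed
  then show ?thesis using False by (simp add: extend_by_zero_def[of Gs "Suc p"] unrestricted_derivative_def)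
qed

lemma exterior_derivative_twice:
  "exterior_derivative ori Gs (Suc p) (exterior_derivative ori Gs p F) =
    \<zero>\<^bsub>forms Gs (Suc (Suc p))\<^esub>"
proof
  fix xs
  show "exterior_derivative ori Gs (Suc p) (exterior_derivative ori Gs p F) xs =
    \<zero>\<^bsub>forms Gs (Suc (Suc p))\<^esub> xs"
  proof (cases "xs \<in> degree_tuples Gs (Suc (Suc p))")
    case True
    let ?F = "extend_by_zero Gs p F"
    have xs: "length xs = length Gs" "\<And>j. j < length Gs \<Longrightarrow> xs ! j \<in> Gs ! j"
      using True by (auto simp: degree_tuples_def interacting_tuples_def)
    have "exterior_derivative ori Gs (Suc p) (exterior_derivative ori Gs p F) xs =
        unrestricted_derivative L ori (length Gs)
          (extend_by_zero Gs (Suc p) (exterior_derivative ori Gs p F)) xs"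
      using True by (rule exterior_derivative_eq)
    also have "\<dots> = unrestricted_derivative L ori (length Gs) (unrestricted_derivative L ori (length Gs) ?F) xs"
      unfolding unrestricted_derivative_def[of L ori "length Gs" _ xs]
      by (intro sum.cong refl arg_cong2[of _ _ _ _ "(*)"] extend_by_zero_exterior_derivative[OF True]) auto
    also have "\<dots> = 0"
    proof (rule unrestricted_derivative_twice)
      fix j assume j: "j < length Gs"
      then have "Gs ! j \<in> set Gs" by simp
      then show "finite (xs ! j) \<and> xs ! j \<subseteq> set L"
        using complex[of "Gs ! j"] vertices_L[of "Gs ! j"] xs(2)[OF j]
        by (auto simp: finite_simplicial_complex_def)
    qed (use xs extend_by_zero_empty in auto)
    finally show ?thesis using True by (simp add: forms_def class_ring.func_space_def)
  \<comment> \<open>Off the tuples of degree \<open>Suc (Suc p)\<close> both sides take the value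
    \<open>undefined\<close> of extensional functions.\<close>
  qed (simp add: forms_def class_ring.func_space_def exterior_derivative_def)
qed

end

section \<open>Dimensions of subspaces and quotients\<close>

text \<open>Independent subsets of \<open>W\<close> stay independent in \<open>V\<close>, which
  bounds their size by \<open>dim\<close>. A maximal one therefore exists, and it spans
  \<open>W\<close>.\<close>

lemma (in vectorspace) subspace_fin_dim:
  assumes "fin_dim" and sub: "subspace K W V"
  shows "vectorspace.fin_dim K (vs W)"
proof -
  interpret W: vectorspace K "vs W" using sub by (rule subspace_is_vs)
  have subm: "submodule K W V" using sub by (simp add: subspace_def)
  have WV: "W \<subseteq> carrier V" using subm by (simp add: submodule_def)
  have bound: "finite A \<and> card A \<le> dim" if "A \<subseteq> carrier (vs W) \<and> W.lin_indpt A" for A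
  proof -
    have "A \<subseteq> W" using that by simp
    then have "lin_indpt A" using that span_li_not_depend(2)[OF _ subm] by simp
    then show ?thesis using li_le_dim[OF \<open>fin_dim\<close>] \<open>A \<subseteq> W\<close> WV by auto
  qed
  have "\<exists>A. finite A \<and> maximal A (\<lambda>S. S \<subseteq> carrier (vs W) \<and> W.lin_indpt S)"
    by (rule maximal_exists[OF bound, of _ "{}"]) (auto simp: W.lin_dep_def)
  then obtain A where "finite A" and A: "maximal A (\<lambda>S. S \<subseteq> carrier (vs W) \<and> W.lin_indpt S)"
    by blast
  moreover have "W.gen_set A" using A by (rule W.max_li_is_gen)
  ultimately show ?thesis unfolding W.fin_dim_def maximal_def by blast
qed

lemma (in vectorspace) quotient_module_simps:
  assumes sub: "subspace K W V"
  shows quotient_carrier: "carrier (quotient_module V W) = (\<lambda>x. W +>\<^bsub>V\<^esub> x) ` carrier V"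
    and quotient_zero: "\<zero>\<^bsub>quotient_module V W\<^esub> = W +>\<^bsub>V\<^esub> \<zero>\<^bsub>V\<^esub>"
    and quotient_add: "\<And>x y. x \<in> carrier V \<Longrightarrow> y \<in> carrier V \<Longrightarrow>
          (W +>\<^bsub>V\<^esub> x) \<oplus>\<^bsub>quotient_module V W\<^esub> (W +>\<^bsub>V\<^esub> y) = W +>\<^bsub>V\<^esub> (x \<oplus>\<^bsub>V\<^esub> y)"
    and quotient_smult: "\<And>c x. c \<in> carrier K \<Longrightarrow> x \<in> carrier V \<Longrightarrow>
          c \<odot>\<^bsub>quotient_module V W\<^esub> (W +>\<^bsub>V\<^esub> x) = W +>\<^bsub>V\<^esub> (c \<odot>\<^bsub>V\<^esub> x)"
    and quotient_coset_eq_zero: "\<And>x. x \<in> carrier V \<Longrightarrow> W +>\<^bsub>V\<^esub> x = W +>\<^bsub>V\<^esub> \<zero>\<^bsub>V\<^esub> \<longleftrightarrow> x \<in> W"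
proof -
  interpret W: submodule K W V using sub by (simp add: subspace_def)
  have "subgroup W (add_monoid V)"
  proof
    show "inv\<^bsub>add_monoid V\<^esub> x \<in> W" if "x \<in> W" for x
    proof -
      \<comment> \<open>Closure under negation comes from closure under the scalar -1.\<close>
      have "\<ominus>\<^bsub>V\<^esub> x = (\<ominus>\<^bsub>K\<^esub> \<one>\<^bsub>K\<^esub>) \<odot>\<^bsub>V\<^esub> x" using that W.subset by (auto simp: smult_minus_1)
      also have "\<dots> \<in> W" using that by auto
      finally show ?thesis by (simp add: a_inv_def)
    qed
  qed (use W.subset in auto)
  then have as: "additive_subgroup W V" by (rule additive_subgroupI)
  then interpret A: abelian_subgroup W V
    by (rule abelian_subgroupI3) (rule abelian_group_axioms)
  show "carrier (quotient_module V W) = (\<lambda>x. W +>\<^bsub>V\<^esub> x) ` carrier V"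
    by (auto simp: quotient_module_def A_RCOSETS_def')
  show "\<zero>\<^bsub>quotient_module V W\<^esub> = W +>\<^bsub>V\<^esub> \<zero>\<^bsub>V\<^esub>"
    using W.subset by (simp add: quotient_module_def)
  show "(W +>\<^bsub>V\<^esub> x) \<oplus>\<^bsub>quotient_module V W\<^esub> (W +>\<^bsub>V\<^esub> y) = W +>\<^bsub>V\<^esub> (x \<oplus>\<^bsub>V\<^esub> y)"
    if "x \<in> carrier V" "y \<in> carrier V" for x y
    using that by (simp add: quotient_module_def A.a_rcos_sum)
  show "W +>\<^bsub>V\<^esub> x = W +>\<^bsub>V\<^esub> \<zero>\<^bsub>V\<^esub> \<longleftrightarrow> x \<in> W" if "x \<in> carrier V" for x
    using that W.subset A.a_subgroup
    by (metis a_coset_add_zero a_coset_join1 a_coset_join2)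
  show "c \<odot>\<^bsub>quotient_module V W\<^esub> (W +>\<^bsub>V\<^esub> x) = W +>\<^bsub>V\<^esub> (c \<odot>\<^bsub>V\<^esub> x)"
    if c: "c \<in> carrier K" and x: "x \<in> carrier V" for c x
  proof -
    \<comment> \<open>Elements of the scaled coset are regrouped to separate their part in
      \<open>W\<close> from the multiple of \<open>x\<close>.\<close>
    have eq: "w \<oplus>\<^bsub>V\<^esub> c \<odot>\<^bsub>V\<^esub> (w' \<oplus>\<^bsub>V\<^esub> x) = (w \<oplus>\<^bsub>V\<^esub> c \<odot>\<^bsub>V\<^esub> w') \<oplus>\<^bsub>V\<^esub> c \<odot>\<^bsub>V\<^esub> x"
      if "w \<in> W" "w' \<in> W" for w w'
    proof -
      have "w \<in> carrier V" "w' \<in> carrier V" using that W.subset by auto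
      then show ?thesis using c x by (simp add: smult_r_distr a_assoc)
    qed
    have "c \<odot>\<^bsub>quotient_module V W\<^esub> (W +>\<^bsub>V\<^esub> x) =
        {w \<oplus>\<^bsub>V\<^esub> c \<odot>\<^bsub>V\<^esub> (w' \<oplus>\<^bsub>V\<^esub> x) | w w'. w \<in> W \<and> w' \<in> W}"
      by (auto simp: quotient_module_def set_add_def' a_r_coset_def')
    also have "\<dots> = {(w \<oplus>\<^bsub>V\<^esub> c \<odot>\<^bsub>V\<^esub> w') \<oplus>\<^bsub>V\<^esub> c \<odot>\<^bsub>V\<^esub> x | w w'. w \<in> W \<and> w' \<in> W}"
      using eq by (metis (no_types, opaque_lifting))
    also have "\<dots> = W +>\<^bsub>V\<^esub> (c \<odot>\<^bsub>V\<^esub> x)"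
    proof
      show "{(w \<oplus>\<^bsub>V\<^esub> c \<odot>\<^bsub>V\<^esub> w') \<oplus>\<^bsub>V\<^esub> c \<odot>\<^bsub>V\<^esub> x | w w'. w \<in> W \<and> w' \<in> W} \<subseteq> W +>\<^bsub>V\<^esub> (c \<odot>\<^bsub>V\<^esub> x)"
        using W.m_closed[OF _ W.smult_closed[OF c]] unfolding a_r_coset_def' by blast
      show "W +>\<^bsub>V\<^esub> (c \<odot>\<^bsub>V\<^esub> x) \<subseteq> {(w \<oplus>\<^bsub>V\<^esub> c \<odot>\<^bsub>V\<^esub> w') \<oplus>\<^bsub>V\<^esub> c \<odot>\<^bsub>V\<^esub> x | w w'. w \<in> W \<and> w' \<in> W}"
      proof
        fix z assume "z \<in> W +>\<^bsub>V\<^esub> (c \<odot>\<^bsub>V\<^esub> x)"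
        then obtain w where w: "w \<in> W" "z = w \<oplus>\<^bsub>V\<^esub> c \<odot>\<^bsub>V\<^esub> x" by (auto simp: a_r_coset_def')
        moreover have "w \<in> carrier V" using w(1) W.subset by auto
        \<comment> \<open>Taking \<open>w' = 0\<close> recovers any element of the target coset,
          also for \<open>c = 0\<close>.\<close>
        ultimately have "z = (w \<oplus>\<^bsub>V\<^esub> c \<odot>\<^bsub>V\<^esub> \<zero>\<^bsub>V\<^esub>) \<oplus>\<^bsub>V\<^esub> c \<odot>\<^bsub>V\<^esub> x" using c by simp
        then show "z \<in> {(w \<oplus>\<^bsub>V\<^esub> c \<odot>\<^bsub>V\<^esub> w') \<oplus>\<^bsub>V\<^esub> c \<odot>\<^bsub>V\<^esub> x | w w'. w \<in> W \<and> w' \<in> W}"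
          using w(1) W.zero_closed by blast
      qed
    qed
    finally show ?thesis .
  qed
qed

lemma (in vectorspace) quotient_vectorspace:
  assumes sub: "subspace K W V"
  shows "vectorspace K (quotient_module V W)"
proof (rule vs_criteria)
  note q = quotient_module_simps[OF sub]
  show "field K" by (rule field_axioms)
  show "\<forall>v\<in>carrier (quotient_module V W).
      \<exists>neg_v\<in>carrier (quotient_module V W). v \<oplus>\<^bsub>quotient_module V W\<^esub> neg_v = \<zero>\<^bsub>quotient_module V W\<^esub>"
  proof
    fix v assume "v \<in> carrier (quotient_module V W)"
    then obtain x where x: "x \<in> carrier V" "v = W +>\<^bsub>V\<^esub> x" by (auto simp: q)
    then have "v \<oplus>\<^bsub>quotient_module V W\<^esub> (W +>\<^bsub>V\<^esub> (\<ominus>\<^bsub>V\<^esub> x)) = \<zero>\<^bsub>quotient_module V W\<^esub>"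
      by (simp add: q r_neg)
    then show "\<exists>neg_v\<in>carrier (quotient_module V W).
        v \<oplus>\<^bsub>quotient_module V W\<^esub> neg_v = \<zero>\<^bsub>quotient_module V W\<^esub>"
      using x by (auto simp: q)
  qed
  show "\<forall>v w. v \<in> carrier (quotient_module V W) \<and> w \<in> carrier (quotient_module V W) \<longrightarrow>
      v \<oplus>\<^bsub>quotient_module V W\<^esub> w = w \<oplus>\<^bsub>quotient_module V W\<^esub> v"
    by (auto simp: q a_comm)
  show "\<forall>v w x. v \<in> carrier (quotient_module V W) \<and> w \<in> carrier (quotient_module V W) \<and>
      x \<in> carrier (quotient_module V W) \<longrightarrow>
      v \<oplus>\<^bsub>quotient_module V W\<^esub> w \<oplus>\<^bsub>quotient_module V W\<^esub> x =
      v \<oplus>\<^bsub>quotient_module V W\<^esub> (w \<oplus>\<^bsub>quotient_module V W\<^esub> x)"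
    by (auto simp: q a_assoc)
qed (auto simp: quotient_module_simps[OF sub] smult_assoc1 smult_l_distr smult_r_distr)

text \<open>Rank-nullity for the projection, which is surjective with kernel
  \<open>W\<close>.\<close>

lemma (in vectorspace) quotient_dim:
  assumes "fin_dim" and sub: "subspace K W V"
  shows "vectorspace.dim K (quotient_module V W) + vectorspace.dim K (vs W) = dim"
proof -
  note q = quotient_module_simps[OF sub]
  interpret Q: vectorspace K "quotient_module V W" using sub by (rule quotient_vectorspace)
  interpret \<pi>: linear_map K V "quotient_module V W" "\<lambda>x. W +>\<^bsub>V\<^esub> x"
    by unfold_locales (auto simp: LinearCombinations.module_hom_def q)
  have "W \<subseteq> carrier V" using sub by (simp add: subspace_def submodule_def)
  then have "\<pi>.ker = W"
    unfolding \<pi>.ker_def quotient_zero[OF sub] using quotient_coset_eq_zero[OF sub] by blast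
  moreover have "\<pi>.im = carrier (quotient_module V W)" by (simp add: \<pi>.im_def q)
  ultimately show ?thesis using \<pi>.rank_nullity[OF \<open>fin_dim\<close>] by simp
qed

lemma (in vectorspace) zero_subspace: "subspace K {\<zero>\<^bsub>V\<^esub>} V"
  unfolding subspace_def using vectorspace_axioms by (auto intro!: submodule.intro module_axioms)

lemma (in vectorspace) dim_zero_subspace: "vectorspace.dim K (vs {\<zero>\<^bsub>V\<^esub>}) = 0"
proof -
  interpret Z: vectorspace K "vs {\<zero>\<^bsub>V\<^esub>}" using zero_subspace by (rule subspace_is_vs)
  have "Z.span {\<zero>\<^bsub>V\<^esub>} = {\<zero>\<^bsub>V\<^esub>}"
    using Z.span_is_subset2[of "{\<zero>\<^bsub>V\<^esub>}"] Z.span_zero[of "{\<zero>\<^bsub>V\<^esub>}"] by auto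
  then show ?thesis using Z.dim0I by simp
qed

section \<open>Function spaces on finite sets\<close>

lemma func_space_vectorspace:
  "vectorspace class_ring (ring.func_space (class_ring :: 'k::field ring) S)"
proof -
  \<comment> \<open>Vectors of length 0 are merely a convenient instance that makes
    \<open>func_space_is_vs\<close> available over \<open>'k\<close>.\<close>
  interpret vectorspace "class_ring :: 'k ring" "module_vec TYPE('k) 0" by (rule vec_vs)
  show ?thesis by (rule func_space_is_vs)
qed

lemma func_space_sel:
  "carrier (ring.func_space (class_ring :: 'k::field ring) S) = S \<rightarrow>\<^sub>E UNIV"
  "f \<oplus>\<^bsub>ring.func_space (class_ring :: 'k::field ring) S\<^esub> g = (\<lambda>v\<in>S. f v + g v)"
  "c \<odot>\<^bsub>ring.func_space (class_ring :: 'k::field ring) S\<^esub> f = (\<lambda>v\<in>S. c * f v)"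
  "\<zero>\<^bsub>ring.func_space (class_ring :: 'k::field ring) S\<^esub> = (\<lambda>v\<in>S. 0)"
  by (simp_all add: class_ring.func_space_def)

text \<open>Numbering \<open>S\<close> by a bijection \<open>e\<close> identifies functions on
  \<open>S\<close> with coordinate vectors of length \<open>card S\<close>; dimension is carried
  over along this isomorphism.\<close>

lemma func_space_finite_dim:
  fixes S :: "'b set"
  assumes "finite S"
  shows "vectorspace.fin_dim class_ring (ring.func_space (class_ring :: 'k::field ring) S)"
    and "vectorspace.dim class_ring (ring.func_space (class_ring :: 'k::field ring) S) = card S"
proof -
  let ?F = "ring.func_space (class_ring :: 'k ring) S"
  interpret F: vectorspace class_ring ?F by (rule func_space_vectorspace)
  interpret V: vec_space "TYPE('k)" "card S" .
  obtain e where e: "bij_betw e S {..<card S}"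
    using ex_bij_betw_finite_nat[OF \<open>finite S\<close>] by (auto simp: lessThan_atLeast0)
  have lt: "e s < card S" if "s \<in> S" for s using e that by (auto simp: bij_betw_def)
  define T where "T = (\<lambda>v :: 'k vec. \<lambda>s\<in>S. v $ e s)"
  interpret T: linear_map "class_ring :: 'k ring" "module_vec TYPE('k) (card S)" ?F T
  proof unfold_locales
    show "T \<in> LinearCombinations.module_hom class_ring (module_vec TYPE('k) (card S)) ?F"
      by (auto simp: LinearCombinations.module_hom_def func_space_sel T_def lt module_vec_simps fun_eq_iff)
  qed
  have inj: "inj_on T (carrier (module_vec TYPE('k) (card S)))"
  proof (rule inj_onI)
    fix v w assume v: "v \<in> carrier (module_vec TYPE('k) (card S))"
      and w: "w \<in> carrier (module_vec TYPE('k) (card S))" and eq: "T v = T w"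
    show "v = w"
    proof (rule eq_vecI)
      show "dim_vec v = dim_vec w" using v w by (simp add: module_vec_simps)
      fix i assume "i < dim_vec w"
      then have "i < card S" using w by (simp add: module_vec_simps)
      then have "i \<in> e ` S" using e by (auto simp: bij_betw_def)
      then obtain s where "s \<in> S" "i = e s" by blast
      then show "v $ i = w $ i" using fun_cong[OF eq, of s] by (simp add: T_def)
    qed
  qed
  have surj: "T ` carrier (module_vec TYPE('k) (card S)) = carrier ?F"
  proof (intro equalityI subsetI)
    fix f assume "f \<in> carrier ?F"
    then have "f = T (vec (card S) (\<lambda>i. f (inv_into S e i)))"
      using e lt by (auto simp: func_space_sel T_def fun_eq_iff PiE_def extensional_def bij_betw_def)
    then show "f \<in> T ` carrier (module_vec TYPE('k) (card S))"
      by (auto simp: module_vec_simps)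
  qed (auto simp: T_def func_space_sel)
  show "F.fin_dim" using T.surj_fin_dim[OF V.fin_dim surj] .
  show "F.dim = card S" using T.dim_eq[OF V.fin_dim inj surj] V.dim_is_n by simp
qed

section \<open>Cohomology and the Wu characteristic\<close>

lemma eval_chain_add: "eval_chain (\<lambda>ys. F ys + G ys) xs j c = eval_chain F xs j c + eval_chain G xs j c"
  by (simp add: eval_chain_def sum.distrib distrib_left)

lemma eval_chain_scale: "eval_chain (\<lambda>ys. a * F ys) xs j c = a * eval_chain F xs j c"
  by (simp add: eval_chain_def sum_distrib_left mult_ac)

lemma forms_vectorspace: "vectorspace class_ring (forms Gs p)"
  unfolding forms_def by (rule func_space_vectorspace)

lemma exterior_derivative_linear:
  "linear_map class_ring (forms Gs p) (forms Gs (Suc p)) (exterior_derivative ori Gs p)"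
proof -
  interpret V: vectorspace class_ring "forms Gs p" by (rule forms_vectorspace)
  interpret W: vectorspace class_ring "forms Gs (Suc p)" by (rule forms_vectorspace)
  let ?d = "exterior_derivative ori Gs p"
  \<comment> \<open>The restriction disappears here, since off \<open>degree_tuples Gs p\<close> the
    extension is 0 on both sides.\<close>
  have ext_add: "extend_by_zero Gs p (\<lambda>v\<in>degree_tuples Gs p. F v + H v) =
      (\<lambda>ys. extend_by_zero Gs p F ys + extend_by_zero Gs p H ys)" for F H
    by (auto simp: extend_by_zero_def)
  have add: "?d (F \<oplus>\<^bsub>forms Gs p\<^esub> H) = ?d F \<oplus>\<^bsub>forms Gs (Suc p)\<^esub> ?d H" for F H
    unfolding forms_def func_space_sel exterior_derivative_def ext_add eval_chain_add
    by (rule restrict_ext) (simp add: sum.distrib distrib_left)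
  have ext_scale: "extend_by_zero Gs p (\<lambda>v\<in>degree_tuples Gs p. a * F v) =
      (\<lambda>ys. a * extend_by_zero Gs p F ys)" for a F
    by (auto simp: extend_by_zero_def)
  have scale: "?d (a \<odot>\<^bsub>forms Gs p\<^esub> F) = a \<odot>\<^bsub>forms Gs (Suc p)\<^esub> ?d F" for a F
    unfolding forms_def func_space_sel exterior_derivative_def ext_scale eval_chain_scale
    by (rule restrict_ext) (simp add: sum_distrib_left mult_ac)
  have "?d F \<in> carrier (forms Gs (Suc p))" for F
    by (simp add: forms_def func_space_sel exterior_derivative_def)
  then show ?thesis
    by unfold_locales (simp add: LinearCombinations.module_hom_def add scale)
qed

text \<open>The witness \<open>b p\<close> is the dimension of the space of coboundaries in degree \<open>p\<close>.\<close>

lemma (in oriented_complexes) dim_interaction_cohomology: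
  assumes fin: "\<And>p. finite (degree_tuples Gs p)"
  obtains b :: "nat \<Rightarrow> nat" where "b 0 = 0"
    and "\<And>p. vectorspace.dim class_ring (interaction_cohomology ori Gs p) + b p + b (Suc p) =
          card (degree_tuples Gs p)"
proof
  define b where
    "b p = vectorspace.dim class_ring ((forms Gs p)\<lparr>carrier := coboundaries ori Gs p\<rparr>)" for p
  interpret V: vectorspace class_ring "forms Gs p" for p by (rule forms_vectorspace)
  interpret d: linear_map class_ring "forms Gs p" "forms Gs (Suc p)" "exterior_derivative ori Gs p" for p
    by (rule exterior_derivative_linear)
  show "b 0 = 0" using V.dim_zero_subspace by (simp add: b_def coboundaries_def)
  fix p
  have ker: "d.ker p = cocycles ori Gs p" by (auto simp: d.ker_def cocycles_def)
  have im: "d.im q = coboundaries ori Gs (Suc q)" for q by (simp add: d.im_def coboundaries_def)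
  have fin_dim: "V.fin_dim p" and dim: "V.dim p = card (degree_tuples Gs p)"
    unfolding forms_def using func_space_finite_dim[OF fin] by blast+
  \<comment> \<open>Rank-nullity for \<open>d\<close> on degree \<open>p\<close>; its image is
    counted by \<open>b (Suc p)\<close>.\<close>
  have rank: "b (Suc p) + vectorspace.dim class_ring ((forms Gs p)\<lparr>carrier := cocycles ori Gs p\<rparr>) =
      card (degree_tuples Gs p)"
    using d.rank_nullity[OF fin_dim] unfolding b_def ker im dim .
  have Z: "subspace class_ring (cocycles ori Gs p) (forms Gs p)"
    using d.kerT_is_subspace[of p] unfolding ker .
  have B: "subspace class_ring (coboundaries ori Gs p) (forms Gs p)"
  proof (cases p)
    case 0
    then show ?thesis using V.zero_subspace by (simp add: coboundaries_def)
  next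
    case (Suc q)
    then show ?thesis using d.imT_is_subspace[of q] unfolding im by simp
  qed
  \<comment> \<open>In positive degree this is the identity \<open>d \<circ> d = 0\<close>.\<close>
  have BZ: "coboundaries ori Gs p \<subseteq> cocycles ori Gs p"
  proof (cases p)
    case 0
    then show ?thesis using Z by (auto simp: coboundaries_def subspace_def submodule_def)
  next
    case (Suc q)
    then show ?thesis
      using d.f_im[of _ q] by (auto simp: coboundaries_def cocycles_def exterior_derivative_twice)
  qed
  interpret Z: vectorspace class_ring "(forms Gs p)\<lparr>carrier := cocycles ori Gs p\<rparr>"
    using Z by (rule V.subspace_is_vs)
  \<comment> \<open>The quotient is formed inside the cocycles, so the coboundaries must be a
    subspace of that space.\<close>
  have "subspace class_ring (coboundaries ori Gs p) ((forms Gs p)\<lparr>carrier := cocycles ori Gs p\<rparr>)"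
    using B BZ Z.module_axioms Z.vectorspace_axioms by (auto simp: subspace_def submodule_def)
  from Z.quotient_dim[OF V.subspace_fin_dim[OF fin_dim Z] this]
  have "vectorspace.dim class_ring (interaction_cohomology ori Gs p) + b p =
      vectorspace.dim class_ring ((forms Gs p)\<lparr>carrier := cocycles ori Gs p\<rparr>)"
    by (simp add: interaction_cohomology_def b_def)
  then show "vectorspace.dim class_ring (interaction_cohomology ori Gs p) + b p + b (Suc p) =
      card (degree_tuples Gs p)"
    using rank by simp
qed

section \<open>Alternating sums and counting tuples by degree\<close>

lemma alternating_telescope:
  fixes b :: "nat \<Rightarrow> real"
  shows "(\<Sum>p<N. (- 1) ^ p * (b p + b (Suc p))) = b 0 - (- 1) ^ N * b N"
  by (induction N) (simp_all add: algebra_simps)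

lemma alternating_sum_sums:
  fixes h b n :: "nat \<Rightarrow> nat"
  assumes "b 0 = 0" and eq: "\<And>p. h p + b p + b (Suc p) = n p" and n: "\<And>p. p \<ge> N \<Longrightarrow> n p = 0"
  shows "(\<lambda>p. (- 1) ^ p * real (h p)) sums (\<Sum>p<N. (- 1) ^ p * real (n p))"
proof -
  \<comment> \<open>All terms are natural numbers, so a zero total forces each to be 0. This makes
    the series finite, and \<open>b N = 0\<close> removes the end term of the telescoping
    sum.\<close>
  have "h p = 0" "b p = 0" if "p \<ge> N" for p using eq[of p] n[OF that] by simp_all
  then have "(\<lambda>p. (- 1) ^ p * real (h p)) sums (\<Sum>p<N. (- 1) ^ p * real (h p))"
    by (intro sums_finite) auto
  moreover have "(\<Sum>p<N. (- 1) ^ p * real (n p)) =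
      (\<Sum>p<N. (- 1) ^ p * real (h p)) + (\<Sum>p<N. (- 1) ^ p * (real (b p) + real (b (Suc p))))"
    unfolding sum.distrib[symmetric] eq[symmetric] by (simp add: distrib_left add.assoc)
  moreover have "(\<Sum>p<N. (- 1) ^ p * (real (b p) + real (b (Suc p)))) = 0"
    using alternating_telescope[of "\<lambda>p. real (b p)" N] \<open>b 0 = 0\<close> \<open>\<And>p. p \<ge> N \<Longrightarrow> b p = 0\<close> by simp
  ultimately show ?thesis by simp
qed

lemma finite_interacting_tuples:
  assumes "finite G"
  shows "finite (interacting_tuples (replicate k G))"
proof (rule finite_subset)
  show "interacting_tuples (replicate k G) \<subseteq> {xs. set xs \<subseteq> G \<and> length xs = k}"
    by (auto simp: interacting_tuples_def in_set_conv_nth)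
  show "finite {xs. set xs \<subseteq> G \<and> length xs = k}" using assms by (rule finite_lists_length_eq)
qed

text \<open>The product of the simplex signs of a tuple is -1 to the power of its degree, so
  grouping by degree yields signed counts.\<close>

lemma wu_characteristic_degree_sum:
  assumes "finite G" and N: "\<And>p. p \<ge> N \<Longrightarrow> degree_tuples (replicate k G) p = {}"
  shows "wu_characteristic k G = (\<Sum>p<N. (- 1) ^ p * int (card (degree_tuples (replicate k G) p)))"
proof -
  let ?I = "interacting_tuples (replicate k G)"
  have "wu_characteristic k G = (\<Sum>xs\<in>?I. (- 1) ^ tuple_degree xs)"
    unfolding wu_characteristic_def
    by (intro sum.cong)
      (auto simp: interacting_tuples_def tuple_degree_def simplex_sign_def power_sum)
  also have "\<dots> = (\<Sum>p<N. \<Sum>xs\<in>{xs \<in> ?I. tuple_degree xs = p}. (- 1) ^ tuple_degree xs)"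
  proof (rule sum.group[symmetric])
    show "tuple_degree ` ?I \<subseteq> {..<N}"
    proof
      fix p assume "p \<in> tuple_degree ` ?I"
      then have "degree_tuples (replicate k G) p \<noteq> {}" by (auto simp: degree_tuples_def)
      then show "p \<in> {..<N}" using N[of p] by (meson lessThan_iff not_le_imp_less)
    qed
  qed (use finite_interacting_tuples \<open>finite G\<close> in auto)
  also have "\<dots> = (\<Sum>p<N. (- 1) ^ p * int (card (degree_tuples (replicate k G) p)))"
    by (intro sum.cong refl) (simp add: degree_tuples_def)
  finally show ?thesis .
qed

theorem mainTheorem1:
  fixes G :: "'a set set" and ori :: "'a set \<Rightarrow> 'a list" and k :: nat
  assumes "finite_simplicial_complex G"
    and "orientation_of G ori"
    and "k \<ge> 1"
  shows "(\<lambda>p. (- 1) ^ p *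
            real (vectorspace.dim class_ring (interaction_cohomology ori (replicate k G) p)))
         sums real_of_int (wu_characteristic k G)"
proof -
  let ?Gs = "replicate k G"
  have "finite G" "finite (\<Union>G)" using assms(1) by (auto simp: finite_simplicial_complex_def)
  then obtain L where L: "distinct L" "set L = \<Union>G" using finite_distinct_list by blast
  interpret oriented_complexes ?Gs ori L
    using assms L by unfold_locales auto
  have finI: "finite (interacting_tuples ?Gs)" using \<open>finite G\<close> by (rule finite_interacting_tuples)
  then have fin: "finite (degree_tuples ?Gs p)" for p by (simp add: degree_tuples_def)
  \<comment> \<open>Finitely many interacting tuples have bounded degree, so there are no nonzero
    forms from degree \<open>N\<close> on.\<close>
  obtain N where N: "\<And>xs. xs \<in> interacting_tuples ?Gs \<Longrightarrow> tuple_degree xs < N"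
    using finI finite_nat_set_iff_bounded[of "tuple_degree ` interacting_tuples ?Gs"] by auto
  have empty: "degree_tuples ?Gs p = {}" if "p \<ge> N" for p
    using N that by (fastforce simp: degree_tuples_def)
  obtain b where "b 0 = 0" "\<And>p. vectorspace.dim class_ring (interaction_cohomology ori ?Gs p) +
      b p + b (Suc p) = card (degree_tuples ?Gs p)"
    using dim_interaction_cohomology[OF fin] by blast
  then have "(\<lambda>p. (- 1) ^ p * real (vectorspace.dim class_ring (interaction_cohomology ori ?Gs p)))
      sums (\<Sum>p<N. (- 1) ^ p * real (card (degree_tuples ?Gs p)))"
    by (rule alternating_sum_sums) (simp add: empty)
  also have "(\<Sum>p<N. (- 1) ^ p * real (card (degree_tuples ?Gs p))) = real_of_int (wu_characteristic k G)"
    using wu_characteristic_degree_sum[OF \<open>finite G\<close> empty] by simp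
  finally show ?thesis .
qed

end
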